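(* Let $(\alpha,\beta)$ be a Bertrand curve pair in $\mathbb{R}^3$, $\beta=\alpha+\lambda N$, where $\alpha$ has Frenet frame $T,N,B$, curvature $\kappa$ and torsion $\tau$, and let $\theta$ be the angle with $T_\beta=\cos\theta\,T+\sin\theta\,B$. Then the derivatives of the Frenet vectors of $\alpha$ with respect to $B$ are $$D_BT=\Big(\frac{1-\cos\theta}{\sin\theta}\Big)\kappa N,\qquad D_BN=-\Big(\frac{1-\cos\theta}{\sin\theta}\Big)\kappa T+\Big(\frac{1-\cos\theta}{\sin\theta}\Big)\tau B,\qquad D_BB=-\Big(\frac{1-\cos\theta}{\sin\theta}\Big)\tau N.$$
   Context: Setting. $\alpha:I\to\mathbb{R}^3$ is a smooth unit speed curve with arc-length parameter $s$, Frenet frame $T,N,B$, curvature $\kappa>0$ and torsion $\tau>0$, with $T'=\kappa N$, $N'=-\kappa T+\tau B$, $B'=-\tau N$. A prime denotes $d/ds$. A Bertrand curve pair $(\alpha,\beta)$ consists of $\alpha$ and a curve $\beta$ having the same principal normal lines at corresponding points; then $\beta(s)=\alpha(s)+\lambda N(s)$ with $\lambda$ a real constant, and there is a real constant $\mu$ with $\lambda\kappa+\mu\tau=1$. It is assumed that $\lambda\neq0$ and $\mu\neq 0$. Put $\vartheta=\|\beta'(s)\|=\tau\sqrt{\lambda^2+\mu^2}$. The Frenet frame of $\beta$ is $T_\beta=\beta'/\vartheta=\cos\theta\,T+\sin\theta\,B$, $N_\beta=N$, $B_\beta=-\sin\theta\,T+\cos\theta\,B$, where $\theta$ is a constant angle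 with $\sin\theta\neq0$. The curvature and torsion of $\beta$ are $$\kappa_\beta=\frac{\lambda\kappa-\sin^2\theta}{\lambda(1-\lambda\kappa)},\qquad \tau_\beta=\frac{\sin^2\theta}{\lambda^2\tau}.$$ The operators. $D_T$ acts on the Frenet vectors of $\alpha$ by $D_TT=\kappa N$, $D_TN=-\kappa T+\tau B$, $D_TB=-\tau N$. $D_{T_\beta}$ acts on the Frenet vectors of $\beta$ by $D_{T_\beta}T_\beta=\vartheta\kappa_\beta N_\beta$, $D_{T_\beta}N_\beta=-\vartheta\kappa_\beta T_\beta+\vartheta\tau_\beta B_\beta$, $D_{T_\beta}B_\beta=-\vartheta\tau_\beta N_\beta$. All are linear over constants. The operator $D_B$ on the Frenet vectors is the one determined by $D_{T_\beta}=D_{\cos\theta\,T+\sin\theta\,B}=\cos\theta\,D_T+\sin\theta\,D_B$. *)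

theory Defs
  imports "HOL-Analysis.Analysis"
begin

text \<open>
  Curves and vector fields along a curve are functions of a real parameter that only matter on an
  interval \<open>I\<close>.  Derivatives are taken within \<open>I\<close>, so endpoints of \<open>I\<close> get one-sided derivatives.
\<close>

definition ddt :: "real set \<Rightarrow> (real \<Rightarrow> real^3) \<Rightarrow> real \<Rightarrow> real^3" where
  "ddt I X = (\<lambda>s. vector_derivative X (at s within I))"

definition smooth_along :: "real set \<Rightarrow> (real \<Rightarrow> real^3) \<Rightarrow> bool" where
  "smooth_along I X \<longleftrightarrow> (\<forall>n. \<forall>s\<in>I. (ddt I ^^ n) X differentiable (at s within I))"

definition speed :: "real set \<Rightarrow> (real \<Rightarrow> real^3) \<Rightarrow> real \<Rightarrow> real" where
  "speed I c s = norm (ddt I c s)"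

definition tangent :: "real set \<Rightarrow> (real \<Rightarrow> real^3) \<Rightarrow> real \<Rightarrow> real^3" where
  "tangent I c s = ddt I c s /\<^sub>R speed I c s"

text \<open>
  Note \<open>sgn v = v / \<parallel>v\<parallel>\<close>, and \<open>sgn 0 = 0\<close>: where the curvature vanishes there is no principal normal.
\<close>

definition principal_normal :: "real set \<Rightarrow> (real \<Rightarrow> real^3) \<Rightarrow> real \<Rightarrow> real^3" where
  "principal_normal I c s = sgn (ddt I (tangent I c) s)"

text \<open>
  Binormal, curvature and torsion are taken relative to a choice \<open>N\<close> of unit vector field on the
  principal normal lines.  For \<open>N = principal_normal I c\<close> they are the usual ones, with curvature
  \<open>\<parallel>T'\<parallel> / \<parallel>c'\<parallel>\<close>.  For a Bertrand mate \<open>\<beta>\<close> of \<open>\<alpha>\<close> the convention is \<open>N\<^sub>\<beta> = N\<^sub>\<alpha>\<close>, which can be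
  opposite to the principal normal of \<open>\<beta>\<close>; the curvature of \<open>\<beta>\<close> is then negative.
\<close>

definition binormal :: "real set \<Rightarrow> (real \<Rightarrow> real^3) \<Rightarrow> (real \<Rightarrow> real^3) \<Rightarrow> real \<Rightarrow> real^3" where
  "binormal I c N s = cross3 (tangent I c s) (N s)"

definition curvature :: "real set \<Rightarrow> (real \<Rightarrow> real^3) \<Rightarrow> (real \<Rightarrow> real^3) \<Rightarrow> real \<Rightarrow> real" where
  "curvature I c N s = (ddt I (tangent I c) s \<bullet> N s) / speed I c s"

definition torsion :: "real set \<Rightarrow> (real \<Rightarrow> real^3) \<Rightarrow> (real \<Rightarrow> real^3) \<Rightarrow> real \<Rightarrow> real" where
  "torsion I c N s = - (ddt I (binormal I c N) s \<bullet> N s) / speed I c s"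

definition principal_normal_line :: "real set \<Rightarrow> (real \<Rightarrow> real^3) \<Rightarrow> real \<Rightarrow> (real^3) set" where
  "principal_normal_line I c s = {c s + u *\<^sub>R principal_normal I c s | u. True}"

text \<open>
  Both curves must be regular with nonvanishing curvature, so that the principal normal lines exist.
\<close>

definition bertrand_pair :: "real set \<Rightarrow> (real \<Rightarrow> real^3) \<Rightarrow> (real \<Rightarrow> real^3) \<Rightarrow> bool" where
  "bertrand_pair I \<alpha> \<beta> \<longleftrightarrow>
     (\<forall>c\<in>{\<alpha>, \<beta>}. smooth_along I c \<and>
        (\<forall>s\<in>I. ddt I c s \<noteq> 0 \<and> ddt I (tangent I c) s \<noteq> 0)) \<and>
     (\<forall>s\<in>I. principal_normal_line I \<alpha> s = principal_normal_line I \<beta> s)"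

text \<open>
  The operators act on the vector fields along \<open>I\<close> that are combinations of the frame vectors with
  constant coefficients.  Fields that agree on \<open>I\<close> are identified.
\<close>

definition frame_span ::
  "real set \<Rightarrow> (real \<Rightarrow> real^3) \<Rightarrow> (real \<Rightarrow> real^3) \<Rightarrow> (real \<Rightarrow> real^3) \<Rightarrow> (real \<Rightarrow> real^3) set" where
  "frame_span I T N B = {X. \<exists>a b c. \<forall>s\<in>I. X s = a *\<^sub>R T s + b *\<^sub>R N s + c *\<^sub>R B s}"

definition linear_over_constants ::
  "real set \<Rightarrow> (real \<Rightarrow> real^3) set \<Rightarrow> ((real \<Rightarrow> real^3) \<Rightarrow> (real \<Rightarrow> real^3)) \<Rightarrow> bool" where
  "linear_over_constants I V D \<longleftrightarrow>
     (\<forall>X\<in>V. \<forall>Y\<in>V. (\<forall>s\<in>I. X s = Y s) \<longrightarrow> (\<forall>s\<in>I. D X s = D Y s)) \<and>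
     (\<forall>X\<in>V. \<forall>Y\<in>V. \<forall>s\<in>I. D (\<lambda>t. X t + Y t) s = D X s + D Y s) \<and>
     (\<forall>a. \<forall>X\<in>V. \<forall>s\<in>I. D (\<lambda>t. a *\<^sub>R X t) s = a *\<^sub>R D X s)"

definition frenet_operator ::
  "real set \<Rightarrow> (real \<Rightarrow> real^3) \<Rightarrow> (real \<Rightarrow> real^3) \<Rightarrow> (real \<Rightarrow> real^3) \<Rightarrow>
     (real \<Rightarrow> real) \<Rightarrow> (real \<Rightarrow> real) \<Rightarrow> ((real \<Rightarrow> real^3) \<Rightarrow> (real \<Rightarrow> real^3)) \<Rightarrow> bool" where
  "frenet_operator I T N B p q D \<longleftrightarrow>
     linear_over_constants I (frame_span I T N B) D \<and>
     (\<forall>s\<in>I. D T s = p s *\<^sub>R N s \<and>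
            D N s = - p s *\<^sub>R T s + q s *\<^sub>R B s \<and>
            D B s = - q s *\<^sub>R N s)"

end

theory Submission
  imports Defs
begin

text \<open>
  Since \<open>T\<^sub>\<beta>\<close> and \<open>B\<^sub>\<beta>\<close> arise from \<open>T\<close> and \<open>B\<close> by the rotation through the constant angle \<open>\<theta>\<close> about
  \<open>N\<close>, differentiating gives \<open>v \<kappa>\<^sub>\<beta> = cos \<theta> \<kappa> - sin \<theta> \<tau>\<close> and \<open>v \<tau>\<^sub>\<beta> = sin \<theta> \<kappa> + cos \<theta> \<tau>\<close>.  Rotating
  back shows that \<open>D\<^sub>T\<^sub>\<beta>\<close> agrees with \<open>D\<^sub>T\<close> on \<open>T, N, B\<close>, so the defining relation of \<open>D\<^sub>B\<close> reads
  \<open>sin \<theta> D\<^sub>B = (1 - cos \<theta>) D\<^sub>T\<close>.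
\<close>

text \<open>A connected set with more than one point has no isolated points. This makes derivatives
  within \<open>I\<close> unique, endpoints included, so that \<open>ddt\<close> can be computed
  from any derivative found.\<close>

lemma at_within_interval_neq_bot:
  fixes I :: "real set"
  assumes "is_interval I" "\<exists>a\<in>I. \<exists>b\<in>I. a < b" "s \<in> I"
  shows "at s within I \<noteq> bot"
proof -
  have "connected I"
    using assms(1) is_interval_connected by blast
  moreover have "I \<noteq> {s}"
    using assms(2) by auto
  ultimately have "s islimpt I"
    using assms(3) connected_imp_perfect by blast
  then show ?thesis
    by (simp add: trivial_limit_within)
qed

lemma ddt_has_vector_derivative:
  assumes "X differentiable (at s within I)"
  shows "(X has_vector_derivative ddt I X s) (at s within I)"
  using assms unfolding ddt_def by (simp add: vector_derivative_works)

lemma ddt_eqI: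
  assumes "(X has_vector_derivative d) (at s within I)" "at s within I \<noteq> bot"
  shows "ddt I X s = d"
  using assms unfolding ddt_def by (intro vector_derivative_within)

lemma differentiable_within_cong:
  assumes "X differentiable (at s within I)" "s \<in> I" "\<And>t. t \<in> I \<Longrightarrow> Y t = X t"
  shows "Y differentiable (at s within I)"
proof -
  obtain f where "(X has_derivative f) (at s within I)"
    using assms(1) differentiable_def by blast
  then have "(Y has_derivative f) (at s within I)"
    by (rule has_derivative_transform[rotated 2]) (use assms in auto)
  then show ?thesis
    using differentiable_def by blast
qed

text \<open>A derivative within \<open>I\<close> sees only values on \<open>I\<close>, so
  \<open>Z\<close> has to match the combination there and nowhere else.\<close>

lemma ddt_lincomb:
  assumes "at s within I \<noteq> bot" "s \<in> I"
    and "X differentiable (at s within I)" "Y differentiable (at s within I)"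
    and "\<And>t. t \<in> I \<Longrightarrow> Z t = a *\<^sub>R X t + b *\<^sub>R Y t"
  shows "ddt I Z s = a *\<^sub>R ddt I X s + b *\<^sub>R ddt I Y s"
proof (rule ddt_eqI[OF _ assms(1)])
  have "((\<lambda>t. a *\<^sub>R X t + b *\<^sub>R Y t) has_vector_derivative
      a *\<^sub>R ddt I X s + b *\<^sub>R ddt I Y s) (at s within I)"
    by (intro has_vector_derivative_add bounded_linear.has_vector_derivative[OF bounded_linear_scaleR_right]
        ddt_has_vector_derivative assms)
  then show "(Z has_vector_derivative a *\<^sub>R ddt I X s + b *\<^sub>R ddt I Y s) (at s within I)"
    by (rule has_vector_derivative_transform[rotated 2]) (use assms in auto)
qed

text \<open>Differentiating the constant \<open>X t \<bullet> X t\<close> gives twice this inner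
  product. For the tangent it yields orthogonality to the principal normal.\<close>

lemma unit_field_orthogonal_ddt:
  assumes "at s within I \<noteq> bot" "s \<in> I" "X differentiable (at s within I)"
    and "\<And>t. t \<in> I \<Longrightarrow> norm (X t) = 1"
  shows "X s \<bullet> ddt I X s = 0"
proof -
  have "((\<lambda>t. X t \<bullet> X t) has_vector_derivative X s \<bullet> ddt I X s + ddt I X s \<bullet> X s) (at s within I)"
    by (intro bounded_bilinear.has_vector_derivative[OF bounded_bilinear_inner]
        ddt_has_vector_derivative assms)
  moreover have "((\<lambda>t. X t \<bullet> X t) has_vector_derivative 0) (at s within I)"
    by (rule has_vector_derivative_transform[OF assms(2), of _ "\<lambda>_. 1"])
      (use assms(4) in \<open>auto simp: dot_square_norm\<close>)
  ultimately have "X s \<bullet> ddt I X s + ddt I X s \<bullet> X s = 0"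
    using vector_derivative_within assms(1) by metis
  then show ?thesis
    by (simp add: inner_commute)
qed

text \<open>Away from 0 the norm is differentiable, hence so is the quotient of \<open>X\<close> by
  its norm. The principal normal is a field of this kind.\<close>

lemma differentiable_sgn_within:
  fixes X :: "real \<Rightarrow> 'a::real_inner"
  assumes "X differentiable (at s within I)" "X s \<noteq> 0"
  shows "(\<lambda>t. sgn (X t)) differentiable (at s within I)"
proof -
  have "(\<lambda>t. norm (X t)) differentiable (at s within I)"
    using differentiable_chain_within[OF assms(1), of norm]
      differentiable_norm_at[OF assms(2)]
    by (simp add: o_def differentiable_at_withinI)
  then show ?thesis
    unfolding sgn_div_norm using assms by (intro differentiable_scaleR differentiable_inverse) auto
qed

text \<open>Linearity speaks of literal pointwise sums and multiples. The clause identifying fields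
  that agree on \<open>I\<close> first replaces \<open>X\<close> by such an expression, which lies
  in the span with \<open>N\<close>-coefficient 0.\<close>

lemma linear_over_constants_lincomb:
  assumes "linear_over_constants I (frame_span I T N B) D" "s \<in> I"
    and X: "\<And>t. t \<in> I \<Longrightarrow> X t = a *\<^sub>R T t + b *\<^sub>R B t"
  shows "D X s = a *\<^sub>R D T s + b *\<^sub>R D B s"
proof -
  let ?V = "frame_span I T N B"
  have lin: "X \<in> ?V \<Longrightarrow> Y \<in> ?V \<Longrightarrow> \<forall>t\<in>I. X t = Y t \<Longrightarrow> D X s = D Y s"
    "X \<in> ?V \<Longrightarrow> Y \<in> ?V \<Longrightarrow> D (\<lambda>t. X t + Y t) s = D X s + D Y s"
    "X \<in> ?V \<Longrightarrow> D (\<lambda>t. c *\<^sub>R X t) s = c *\<^sub>R D X s" for X Y c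
    using assms(1,2) unfolding linear_over_constants_def by blast+
  have span: "(\<lambda>t. x *\<^sub>R T t + y *\<^sub>R B t) \<in> ?V" for x y
    unfolding frame_span_def by (intro CollectI exI[of _ x] exI[of _ 0] exI[of _ y]) simp
  have "T \<in> ?V" "B \<in> ?V" "(\<lambda>t. a *\<^sub>R T t) \<in> ?V" "(\<lambda>t. b *\<^sub>R B t) \<in> ?V"
    using span[of 1 0] span[of 0 1] span[of a 0] span[of 0 b] by simp_all
  moreover have "X \<in> ?V"
    unfolding frame_span_def by (intro CollectI exI[of _ a] exI[of _ 0] exI[of _ b]) (simp add: X)
  moreover have "D X s = D (\<lambda>t. a *\<^sub>R T t + b *\<^sub>R B t) s"
    using lin(1)[OF \<open>X \<in> ?V\<close> span[of a b]] X by simp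
  ultimately have "D X s = D (\<lambda>t. a *\<^sub>R T t) s + D (\<lambda>t. b *\<^sub>R B t) s"
    "D (\<lambda>t. a *\<^sub>R T t) s = a *\<^sub>R D T s" "D (\<lambda>t. b *\<^sub>R B t) s = b *\<^sub>R D B s"
    using lin(2,3) by simp_all
  then show ?thesis
    by simp
qed

text \<open>Primes mark the rotated frame, not derivatives. In a positively oriented orthonormal
  frame the Frenet equations are the cross product with the Darboux vector q T + p B, and q' T' + p'
  B' is that same vector. The proof checks this in coordinates, without using
  orthonormality.\<close>

lemma frenet_operator_rotate:
  assumes D: "frenet_operator I T' N B' p' q' D" and s: "s \<in> I"
    and T': "\<And>t. t \<in> I \<Longrightarrow> T' t = cos \<theta> *\<^sub>R T t + sin \<theta> *\<^sub>R B t"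
    and B': "\<And>t. t \<in> I \<Longrightarrow> B' t = cos \<theta> *\<^sub>R B t - sin \<theta> *\<^sub>R T t"
    and p': "p' s = cos \<theta> * p - sin \<theta> * q"
    and q': "q' s = sin \<theta> * p + cos \<theta> * q"
  shows "D T s = p *\<^sub>R N s"
    and "D N s = - p *\<^sub>R T s + q *\<^sub>R B s"
    and "D B s = - q *\<^sub>R N s"
proof -
  have pyth: "sin \<theta> * sin \<theta> = 1 - cos \<theta> * cos \<theta>"
    using sin_cos_squared_add[of \<theta>] by (simp add: power2_eq_square)
  have lin: "linear_over_constants I (frame_span I T' N B') D"
    and DT': "D T' s = p' s *\<^sub>R N s"
    and DN: "D N s = - p' s *\<^sub>R T' s + q' s *\<^sub>R B' s"
    and DB': "D B' s = - q' s *\<^sub>R N s"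
    using D s unfolding frenet_operator_def by auto
  \<comment> \<open>The inverse rotation, stated on all of \<open>I\<close> because \<open>D\<close>
    acts on fields and not on their values at \<open>s\<close>.\<close>
  have "T t = cos \<theta> *\<^sub>R T' t + (- sin \<theta>) *\<^sub>R B' t"
    and "B t = sin \<theta> *\<^sub>R T' t + cos \<theta> *\<^sub>R B' t" if "t \<in> I" for t
    unfolding T'[OF that] B'[OF that] using pyth
    by (simp_all add: algebra_simps flip: scaleR_add_left)
  then have "D T s = cos \<theta> *\<^sub>R D T' s + (- sin \<theta>) *\<^sub>R D B' s"
    and "D B s = sin \<theta> *\<^sub>R D T' s + cos \<theta> *\<^sub>R D B' s"
    using linear_over_constants_lincomb[OF lin s] by blast+
  then have "D T s = (cos \<theta> * p' s + sin \<theta> * q' s) *\<^sub>R N s"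
    and "D B s = (sin \<theta> * p' s - cos \<theta> * q' s) *\<^sub>R N s"
    unfolding DT' DB' by (simp_all add: algebra_simps)
  \<comment> \<open>Keeping the sum of squares as a factor makes these polynomial identities in sine
    and cosine; \<open>pyth\<close> then reduces the factor to 1.\<close>
  moreover have "cos \<theta> * p' s + sin \<theta> * q' s = (sin \<theta> * sin \<theta> + cos \<theta> * cos \<theta>) * p"
    and "sin \<theta> * p' s - cos \<theta> * q' s = - (sin \<theta> * sin \<theta> + cos \<theta> * cos \<theta>) * q"
    unfolding p' q' by algebra+
  ultimately show "D T s = p *\<^sub>R N s" "D B s = - q *\<^sub>R N s"
    unfolding pyth by simp_all
  have "D N s = - (cos \<theta> * p' s + sin \<theta> * q' s) *\<^sub>R T s + (cos \<theta> * q' s - sin \<theta> * p' s) *\<^sub>R B s"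
    unfolding DN T'[OF s] B'[OF s] by (simp add: algebra_simps)
  moreover have "cos \<theta> * p' s + sin \<theta> * q' s = (sin \<theta> * sin \<theta> + cos \<theta> * cos \<theta>) * p"
    and "cos \<theta> * q' s - sin \<theta> * p' s = (sin \<theta> * sin \<theta> + cos \<theta> * cos \<theta>) * q"
    unfolding p' q' by algebra+
  ultimately show "D N s = - p *\<^sub>R T s + q *\<^sub>R B s"
    unfolding pyth by simp
qed

text \<open>Solves the defining relation of \<open>D\<^sub>B\<close> for \<open>y\<close>, its value
  on a frame vector, once the other two operators share the value \<open>x\<close> there.\<close>

lemma eq_lincomb_self_imp:
  fixes x y :: "'a::real_vector"
  assumes "x = c *\<^sub>R x + d *\<^sub>R y" "d \<noteq> 0"
  shows "y = ((1 - c) / d) *\<^sub>R x"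
proof -
  have "d *\<^sub>R y = (1 - c) *\<^sub>R x"
    using assms(1) by (simp add: algebra_simps)
  then have "(1 / d) *\<^sub>R d *\<^sub>R y = (1 / d) *\<^sub>R (1 - c) *\<^sub>R x"
    by simp
  then show ?thesis
    using assms(2) by simp
qed

theorem theorem2p1:
  fixes I :: "real set"
    and \<alpha> \<beta> T N B T\<^sub>\<beta> N\<^sub>\<beta> B\<^sub>\<beta> :: "real \<Rightarrow> real^3"
    and \<kappa> \<tau> \<kappa>\<^sub>\<beta> \<tau>\<^sub>\<beta> v :: "real \<Rightarrow> real"
    and lam \<mu> \<theta> :: real
    and D\<^sub>T D\<^sub>T\<^sub>\<beta> D\<^sub>B :: "(real \<Rightarrow> real^3) \<Rightarrow> (real \<Rightarrow> real^3)"
  assumes interval: "is_interval I" "\<exists>a\<in>I. \<exists>b\<in>I. a < b"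
    and smooth: "smooth_along I \<alpha>"
    and unit_speed: "\<And>s. s \<in> I \<Longrightarrow> speed I \<alpha> s = 1"
    and frame_\<alpha>: "T = tangent I \<alpha>" "N = principal_normal I \<alpha>" "B = binormal I \<alpha> N"
    and curvature_\<alpha>: "\<kappa> = curvature I \<alpha> N" "\<And>s. s \<in> I \<Longrightarrow> \<kappa> s > 0"
    and torsion_\<alpha>: "\<tau> = torsion I \<alpha> N" "\<And>s. s \<in> I \<Longrightarrow> \<tau> s > 0"
    and bertrand: "bertrand_pair I \<alpha> \<beta>"
    and \<beta>_eq: "\<And>s. s \<in> I \<Longrightarrow> \<beta> s = \<alpha> s + lam *\<^sub>R N s"
    and lam_mu: "\<And>s. s \<in> I \<Longrightarrow> lam * \<kappa> s + \<mu> * \<tau> s = 1" "lam \<noteq> 0" "\<mu> \<noteq> 0"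
    and frame_\<beta>: "T\<^sub>\<beta> = tangent I \<beta>" "N\<^sub>\<beta> = N" "B\<^sub>\<beta> = binormal I \<beta> N\<^sub>\<beta>"
    and invariants_\<beta>: "v = speed I \<beta>" "\<kappa>\<^sub>\<beta> = curvature I \<beta> N\<^sub>\<beta>" "\<tau>\<^sub>\<beta> = torsion I \<beta> N\<^sub>\<beta>"
    and angle: "\<And>s. s \<in> I \<Longrightarrow> T\<^sub>\<beta> s = cos \<theta> *\<^sub>R T s + sin \<theta> *\<^sub>R B s" "sin \<theta> \<noteq> 0"
    and D\<^sub>T: "frenet_operator I T N B \<kappa> \<tau> D\<^sub>T"
    and D\<^sub>T\<^sub>\<beta>: "frenet_operator I T\<^sub>\<beta> N\<^sub>\<beta> B\<^sub>\<beta> (\<lambda>s. v s * \<kappa>\<^sub>\<beta> s) (\<lambda>s. v s * \<tau>\<^sub>\<beta> s) D\<^sub>T\<^sub>\<beta>"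
    and D\<^sub>B: "\<And>X s. X \<in> frame_span I T N B \<Longrightarrow> s \<in> I \<Longrightarrow>
               D\<^sub>T\<^sub>\<beta> X s = cos \<theta> *\<^sub>R D\<^sub>T X s + sin \<theta> *\<^sub>R D\<^sub>B X s"
  shows "\<forall>s\<in>I.
      D\<^sub>B T s = ((1 - cos \<theta>) / sin \<theta> * \<kappa> s) *\<^sub>R N s \<and>
      D\<^sub>B N s = - ((1 - cos \<theta>) / sin \<theta> * \<kappa> s) *\<^sub>R T s + ((1 - cos \<theta>) / sin \<theta> * \<tau> s) *\<^sub>R B s \<and>
      D\<^sub>B B s = - ((1 - cos \<theta>) / sin \<theta> * \<tau> s) *\<^sub>R N s"
proof
  fix s assume s: "s \<in> I"
  have nonbot: "at t within I \<noteq> bot" if "t \<in> I" for t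
    using at_within_interval_neq_bot interval that by blast

  \<comment> \<open>Regularity and orthonormality of the frame of \<alpha>\<close>
  have T_eq: "T t = ddt I \<alpha> t" if "t \<in> I" for t
    using unit_speed[OF that] by (simp add: frame_\<alpha>(1) tangent_def)
  have T_unit: "norm (T t) = 1" if "t \<in> I" for t
    using T_eq[OF that] unit_speed[OF that] by (simp add: speed_def)
  \<comment> \<open>Order 1 serves to differentiate \<open>T\<close>, order 2 to differentiate its
    derivative and hence \<open>N\<close>.\<close>
  have "(ddt I ^^ 1) \<alpha> differentiable (at t within I)"
    and "(ddt I ^^ 2) \<alpha> differentiable (at t within I)" if "t \<in> I" for t
    using smooth that unfolding smooth_along_def by blast+
  then have \<alpha>_diff: "ddt I \<alpha> differentiable (at t within I)"
    "ddt I (ddt I \<alpha>) differentiable (at t within I)" if "t \<in> I" for t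
    using that by (simp_all add: numeral_2_eq_2)
  have T_diff: "T differentiable (at t within I)" if "t \<in> I" for t
    using differentiable_within_cong[OF \<alpha>_diff(1)[OF that] that] T_eq by blast
  \<comment> \<open>The coefficients 1 and 0 turn the combination rule into a congruence rule for
    \<open>ddt\<close>.\<close>
  have ddt_T: "ddt I T t = ddt I (ddt I \<alpha>) t" if "t \<in> I" for t
    using ddt_lincomb[OF nonbot[OF that] that \<alpha>_diff(1)[OF that] \<alpha>_diff(1)[OF that], of T 1 0]
      T_eq by simp
  \<comment> \<open>The curvature is an inner product with this vector, so it would vanish along
    with it.\<close>
  have ddt_T_nz: "ddt I T t \<noteq> 0" if "t \<in> I" for t
    using curvature_\<alpha>(2)[OF that] by (auto simp: curvature_\<alpha>(1) curvature_def frame_\<alpha>(1))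
  have N_eq: "N t = sgn (ddt I T t)" for t
    by (simp add: frame_\<alpha> principal_normal_def)
  have N_unit: "norm (N t) = 1" if "t \<in> I" for t
    using ddt_T_nz[OF that] by (simp add: N_eq norm_sgn)
  have T_orth_N: "T t \<bullet> N t = 0" if "t \<in> I" for t
    using unit_field_orthogonal_ddt[OF nonbot[OF that] that T_diff[OF that] T_unit]
    by (simp add: N_eq sgn_div_norm)
  have "ddt I T differentiable (at s within I)"
    using differentiable_within_cong[OF \<alpha>_diff(2)[OF s] s] ddt_T by blast
  then have N_diff: "N differentiable (at s within I)"
    using differentiable_sgn_within[of "ddt I T" s I] ddt_T_nz[OF s] by (simp add: N_eq[abs_def])
  have B_eq: "B t = cross3 (T t) (N t)" for t
    by (simp add: frame_\<alpha> binormal_def)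
  have B_diff: "B differentiable (at s within I)"
    using bounded_bilinear.has_vector_derivative[OF bilinear_cross[unfolded bilinear_conv_bounded_bilinear]
        ddt_has_vector_derivative[OF T_diff[OF s]] ddt_has_vector_derivative[OF N_diff]]
    by (auto simp: B_eq[abs_def] intro: differentiableI_vector)

  \<comment> \<open>The binormal of \<beta>\<close>
  have B_cross_N: "cross3 (B t) (N t) = - T t" if "t \<in> I" for t
  proof -
    have "cross3 (B t) (N t) = - cross3 (N t) (cross3 (T t) (N t))"
      by (simp add: B_eq cross_skew[of "cross3 (T t) (N t)"])
    also have "\<dots> = - ((N t \<bullet> N t) *\<^sub>R T t - (N t \<bullet> T t) *\<^sub>R N t)"
      by (simp only: Lagrange)
    finally show ?thesis
      using T_orth_N[OF that] N_unit[OF that] by (simp add: inner_commute dot_square_norm)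
  qed
  have B\<^sub>\<beta>_eq: "B\<^sub>\<beta> t = cos \<theta> *\<^sub>R B t - sin \<theta> *\<^sub>R T t" if "t \<in> I" for t
  proof -
    have "B\<^sub>\<beta> t = cross3 (T\<^sub>\<beta> t) (N t)"
      by (simp add: frame_\<beta> binormal_def)
    also have "\<dots> = cos \<theta> *\<^sub>R cross3 (T t) (N t) + sin \<theta> *\<^sub>R cross3 (B t) (N t)"
      by (simp add: angle(1)[OF that] cross_add_left cross_mult_left)
    finally show ?thesis
      using B_cross_N[OF that] by (simp add: B_eq)
  qed

  \<comment> \<open>Curvature and torsion of \<beta>, scaled by its speed\<close>
  have T'_N: "ddt I T s \<bullet> N s = \<kappa> s"
    using unit_speed[OF s] by (simp add: curvature_\<alpha>(1) curvature_def frame_\<alpha>(1))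
  have B'_N: "ddt I B s \<bullet> N s = - \<tau> s"
    using unit_speed[OF s] by (simp add: torsion_\<alpha>(1) torsion_def frame_\<alpha>(3))
  \<comment> \<open>Regularity of \<beta> lets the factor \<open>v\<close> cancel the division by
    speed in \<open>curvature\<close> and \<open>torsion\<close>.\<close>
  have "v s \<noteq> 0"
    using bertrand s by (auto simp: invariants_\<beta>(1) speed_def bertrand_pair_def)
  then have "v s * \<kappa>\<^sub>\<beta> s = ddt I T\<^sub>\<beta> s \<bullet> N s" "v s * \<tau>\<^sub>\<beta> s = - (ddt I B\<^sub>\<beta> s \<bullet> N s)"
    by (simp_all add: invariants_\<beta> curvature_def torsion_def frame_\<beta>)
  moreover have "ddt I T\<^sub>\<beta> s = cos \<theta> *\<^sub>R ddt I T s + sin \<theta> *\<^sub>R ddt I B s"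
    using ddt_lincomb[OF nonbot[OF s] s T_diff[OF s] B_diff] angle(1) by blast
  moreover have "ddt I B\<^sub>\<beta> s = cos \<theta> *\<^sub>R ddt I B s + (- sin \<theta>) *\<^sub>R ddt I T s"
    using ddt_lincomb[OF nonbot[OF s] s B_diff T_diff[OF s], of B\<^sub>\<beta> "cos \<theta>" "- sin \<theta>"] B\<^sub>\<beta>_eq
    by simp
  ultimately have p: "v s * \<kappa>\<^sub>\<beta> s = cos \<theta> * \<kappa> s - sin \<theta> * \<tau> s"
    and q: "v s * \<tau>\<^sub>\<beta> s = sin \<theta> * \<kappa> s + cos \<theta> * \<tau> s"
    using T'_N B'_N by (simp_all add: inner_add_left inner_diff_left)

  \<comment> \<open>The three operators on the frame of \<alpha>\<close>
  have D\<^sub>T\<^sub>\<beta>_frame: "D\<^sub>T\<^sub>\<beta> T s = \<kappa> s *\<^sub>R N s"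
    "D\<^sub>T\<^sub>\<beta> N s = - \<kappa> s *\<^sub>R T s + \<tau> s *\<^sub>R B s" "D\<^sub>T\<^sub>\<beta> B s = - \<tau> s *\<^sub>R N s"
    using frenet_operator_rotate[OF D\<^sub>T\<^sub>\<beta>[unfolded frame_\<beta>(2)] s angle(1) B\<^sub>\<beta>_eq p q] by blast+
  have D\<^sub>T_frame: "D\<^sub>T T s = \<kappa> s *\<^sub>R N s"
    "D\<^sub>T N s = - \<kappa> s *\<^sub>R T s + \<tau> s *\<^sub>R B s" "D\<^sub>T B s = - \<tau> s *\<^sub>R N s"
    using D\<^sub>T s unfolding frenet_operator_def by auto
  have span: "(\<lambda>t. x *\<^sub>R T t + y *\<^sub>R N t + z *\<^sub>R B t) \<in> frame_span I T N B" for x y z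
    unfolding frame_span_def by blast
  have "T \<in> frame_span I T N B" "N \<in> frame_span I T N B" "B \<in> frame_span I T N B"
    using span[of 1 0 0] span[of 0 1 0] span[of 0 0 1] by simp_all
  \<comment> \<open>After unfolding, each relation reads x = cos \<theta> x + sin \<theta> y, where
    y is the value of \<open>D\<^sub>B\<close>.\<close>
  note D\<^sub>B_frame = this[THEN D\<^sub>B, OF s, unfolded D\<^sub>T\<^sub>\<beta>_frame D\<^sub>T_frame, THEN eq_lincomb_self_imp, OF angle(2)]
  show "D\<^sub>B T s = ((1 - cos \<theta>) / sin \<theta> * \<kappa> s) *\<^sub>R N s \<and>
      D\<^sub>B N s = - ((1 - cos \<theta>) / sin \<theta> * \<kappa> s) *\<^sub>R T s + ((1 - cos \<theta>) / sin \<theta> * \<tau> s) *\<^sub>R B s \<and>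
      D\<^sub>B B s = - ((1 - cos \<theta>) / sin \<theta> * \<tau> s) *\<^sub>R N s"
    unfolding D\<^sub>B_frame by (simp add: scaleR_right_diff_distrib)
qed

end
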